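(* There is an absolute constant $C>0$ such that for every prime $p$ we have $N_0(p) \le C p^{2/3}$, where $N_0(p)$ is the number of integers $s \in \{1, \ldots, p-2\}$ with $\vartheta_{p,s} = 0$.
   Context: For a prime $p$ and an integer $u$ with $\gcd(u,p)=1$, the Fermat quotient $q_p(u)$ is the unique integer with $0 \le q_p(u) < p$ and $q_p(u) \equiv (u^{p-1}-1)/p \pmod p$. For a rational number $a/b$ with $a,b$ integers coprime to $p$, $q_p(a/b)$ denotes the residue of $q_p(a) - q_p(b)$ modulo $p$ (equivalently, of $((a/b)^{p-1}-1)/p$ computed in the $p$-adic integers); in particular $q_p\big(s^s/(s+1)^{s+1}\big) \equiv s\,q_p(s) - (s+1)\,q_p(s+1) \pmod p$. For $s \in \{1,\ldots,p-2\}$ define the Legendre symbol $$\vartheta_{p,s} = \left(\frac{2s(s+1)\, q_p\big(s^s/(s+1)^{s+1}\big)}{p}\right) \in \{0, 1, -1\}.$$ *)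

theory Defs
  imports Complex_Main "HOL-Number_Theory.Number_Theory"
begin

definition fermat_quotient :: "nat \<Rightarrow> int \<Rightarrow> int" where
  "fermat_quotient p u = ((u ^ (p - 1) - 1) div int p) mod int p"

text \<open>
  Only meaningful for rationals whose reduced numerator and denominator are both prime to \<open>p\<close>.
  The lemma \<open>fermat_quotient_rat_divide\<close> below shows that any other representation as a fraction
  of integers prime to \<open>p\<close> gives the same value.
\<close>
definition fermat_quotient_rat :: "nat \<Rightarrow> rat \<Rightarrow> int" where
  "fermat_quotient_rat p r =
     (fermat_quotient p (fst (quotient_of r)) - fermat_quotient p (snd (quotient_of r))) mod int p"

definition vartheta :: "nat \<Rightarrow> nat \<Rightarrow> int" where
  "vartheta p s =
     Legendre (2 * int s * (int s + 1) *
       fermat_quotient_rat p (of_nat s ^ s / of_nat (s + 1) ^ (s + 1))) (int p)"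

definition N0 :: "nat \<Rightarrow> nat" where
  "N0 p = card {s \<in> {1..p - 2}. vartheta p s = 0}"

lemma fermat_quotient_dvd:
  assumes "prime p" "coprime u (int p)"
  shows "int p dvd u ^ (p - 1) - 1"
proof -
  have ndvd: "\<not> int p dvd u"
    using assms by (metis coprime_absorb_right not_prime_unit prime_nat_int_transfer)
  have pp: "p > 0" using assms(1) prime_gt_0_nat by blast
  define n where "n = nat (u mod int p)"
  have n: "int n = u mod int p" using pp by (simp add: n_def)
  have "\<not> p dvd n"
    using ndvd by (metis n int_dvd_int_iff dvd_mod_iff dvd_refl)
  then have "[n ^ (p - 1) = 1] (mod p)" using fermat_theorem[OF assms(1)] by blast
  then have "[int n ^ (p - 1) = 1] (mod int p)"
    by (metis cong_int_iff of_nat_1 of_nat_power)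
  moreover have "[u ^ (p - 1) = int n ^ (p - 1)] (mod int p)"
    unfolding n by (intro cong_pow) (simp add: cong_def)
  ultimately show ?thesis by (meson cong_iff_dvd_diff cong_trans)
qed

lemma fermat_quotient_eq_mod:
  assumes "int p > 0" "u ^ (p - 1) - 1 = int p * k"
  shows "fermat_quotient p u = k mod int p"
  unfolding fermat_quotient_def assms(2) using assms(1) by simp

lemma fermat_quotient_unique:
  assumes "prime p" "coprime u (int p)" "0 \<le> v" "v < int p"
  shows "fermat_quotient p u = v \<longleftrightarrow> [int p * v = u ^ (p - 1) - 1] (mod (int p)\<^sup>2)"
proof -
  have pp: "int p > 0" using assms(1) prime_gt_0_nat by simp
  obtain k where k: "u ^ (p - 1) - 1 = int p * k"
    using fermat_quotient_dvd[OF assms(1,2)] by (auto simp: dvd_def)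
  have "fermat_quotient p u = k mod int p" by (rule fermat_quotient_eq_mod[OF pp k])
  moreover have "[int p * v = int p * k] (mod (int p)\<^sup>2) \<longleftrightarrow> [v = k] (mod int p)"
    using pp by (simp add: cong_def power2_eq_square mult_mod_right[symmetric])
  ultimately show ?thesis unfolding k using assms(3,4) by (auto simp: cong_def)
qed

lemma fermat_quotient_mult:
  assumes "prime p" "coprime a (int p)" "coprime b (int p)"
  shows "[fermat_quotient p (a * b) = fermat_quotient p a + fermat_quotient p b] (mod int p)"
proof -
  have pp: "int p > 0" using assms(1) prime_gt_0_nat by simp
  obtain k where k: "a ^ (p - 1) - 1 = int p * k"
    using fermat_quotient_dvd[OF assms(1,2)] by (auto simp: dvd_def)
  obtain l where l: "b ^ (p - 1) - 1 = int p * l"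
    using fermat_quotient_dvd[OF assms(1,3)] by (auto simp: dvd_def)
  have "(a * b) ^ (p - 1) - 1 = (int p * k + 1) * (int p * l + 1) - 1"
    using k l by (simp add: power_mult_distrib diff_eq_eq)
  also have "\<dots> = int p * (k + l + int p * (k * l))" by (simp add: algebra_simps)
  finally have m: "(a * b) ^ (p - 1) - 1 = int p * (k + l + int p * (k * l))" .
  show ?thesis
    unfolding fermat_quotient_eq_mod[OF pp k] fermat_quotient_eq_mod[OF pp l]
      fermat_quotient_eq_mod[OF pp m]
    by (simp add: cong_def mod_simps)
qed

lemma fermat_quotient_power:
  assumes "prime p" "coprime a (int p)"
  shows "[fermat_quotient p (a ^ n) = int n * fermat_quotient p a] (mod int p)"
proof (induction n)
  case 0
  then show ?case by (simp add: fermat_quotient_def)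
next
  case (Suc n)
  have "[fermat_quotient p (a * a ^ n) = fermat_quotient p a + fermat_quotient p (a ^ n)] (mod int p)"
    using assms by (intro fermat_quotient_mult) auto
  also have "[fermat_quotient p a + fermat_quotient p (a ^ n) =
      fermat_quotient p a + int n * fermat_quotient p a] (mod int p)"
    using Suc by (intro cong_add) auto
  finally show ?case by (simp add: algebra_simps)
qed

lemma fermat_quotient_rat_divide:
  assumes "prime p" "coprime a (int p)" "coprime b (int p)"
  shows "fermat_quotient_rat p (of_int a / of_int b) =
    (fermat_quotient p a - fermat_quotient p b) mod int p"
proof -
  have b0: "b \<noteq> 0" using assms(1,3) by (auto simp: prime_gt_1_nat)
  obtain c d where cd: "quotient_of (of_int a / of_int b) = (c, d)" by fastforce
  have d: "d > 0" "coprime c d" using quotient_of_denom_pos[OF cd] quotient_of_coprime[OF cd] by auto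
  have "(of_int a / of_int b :: rat) = of_int c / of_int d" using quotient_of_div[OF cd] .
  then have "(of_int (a * d) :: rat) = of_int (c * b)" using b0 d by (simp add: field_simps)
  then have e: "a * d = c * b" using of_int_eq_iff by blast
  have "c dvd a" using e d by (metis coprime_dvd_mult_left_iff dvd_triv_left)
  then have c: "coprime c (int p)" using assms(2) by (meson coprime_divisors dvd_refl)
  have "d dvd b" using e d
    by (metis coprime_commute coprime_dvd_mult_right_iff dvd_triv_right)
  then have dp: "coprime d (int p)" using assms(3) by (meson coprime_divisors dvd_refl)
  have "[fermat_quotient p a + fermat_quotient p d = fermat_quotient p c + fermat_quotient p b] (mod int p)"
    using fermat_quotient_mult[OF assms(1,2) dp] fermat_quotient_mult[OF assms(1) c assms(3)] e
    by (metis cong_sym cong_trans)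
  then have "[fermat_quotient p c - fermat_quotient p d = fermat_quotient p a - fermat_quotient p b] (mod int p)"
    by (simp add: cong_iff_dvd_diff algebra_simps dvd_diff_commute)
  then show ?thesis by (simp add: fermat_quotient_rat_def cd cong_def)
qed

lemma fermat_quotient_rat_self_power:
  assumes "prime p" "s \<in> {1..p - 2}"
  shows "[fermat_quotient_rat p (of_nat s ^ s / of_nat (s + 1) ^ (s + 1)) =
    int s * fermat_quotient p (int s) - (int s + 1) * fermat_quotient p (int s + 1)] (mod int p)"
proof -
  have c: "coprime (int s) (int p)" "coprime (int s + 1) (int p)"
  proof -
    have "\<not> p dvd s" "\<not> p dvd s + 1" using assms(2) by (auto dest!: dvd_imp_le)
    then have "coprime s p" "coprime (s + 1) p"
      using assms(1) by (meson prime_imp_coprime coprime_commute)+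
    then show "coprime (int s) (int p)" "coprime (int s + 1) (int p)"
      by (metis coprime_int_iff of_nat_1 of_nat_add)+
  qed
  have "fermat_quotient_rat p (of_int (int s ^ s) / of_int ((int s + 1) ^ (s + 1))) =
     (fermat_quotient p (int s ^ s) - fermat_quotient p ((int s + 1) ^ (s + 1))) mod int p"
    using c by (intro fermat_quotient_rat_divide assms(1)) auto
  moreover have "[fermat_quotient p (int s ^ s) - fermat_quotient p ((int s + 1) ^ (s + 1)) =
     int s * fermat_quotient p (int s) - int (s + 1) * fermat_quotient p (int s + 1)] (mod int p)"
    using c by (intro cong_diff fermat_quotient_power assms(1))
  ultimately show ?thesis by (simp add: cong_def add.commute)
qed

end

(*
  Stepanov's method, in the form used by Heath-Brown for Heilbronn's exponential sum. Since
  p s q_p(s) = s^p - s (mod p^2), vartheta_{p,s} vanishes exactly when s is a root modulo p of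
  f = ((X + 1)^p - X^p - 1) / p, a truncated logarithm with (X + 1) f' = 1 - X^(p - 1) over F_p.
  The derivation T = X (X + 1) d/dX satisfies T f = X - X^p, hence at a root of f in F_p every
  T^n ((X + 1)^i f^j X^(pk)) takes the same value as a polynomial of degree at most i + j + k + n.
  By a count of coefficients, some nontrivial combination of these products with i < 4c^2 and
  j, k < 2c, where c is about p^(1/3) / 2, is annihilated by T^n for all n < c^2 at all roots of f
  in F_p, so it vanishes there to order c^2. It is nonzero, because f behaves modulo X^p like a
  logarithm, and its degree is at most 4cp. Therefore there are at most 4p/c roots.
*)

theory Submission
  imports Defs "Berlekamp_Zassenhaus.Finite_Field"
begin

section \<open>The truncated logarithm and its differential equation\<close>

text \<open>
  The reduction of the integer polynomial \<open>((X + 1)^p - X^p - 1) / p\<close>, where \<open>p\<close> is the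
  characteristic.
\<close>
definition log_poly :: "'a::comm_ring_1 poly" where
  "log_poly = (\<Sum>k=1..<CHAR('a). monom (of_nat ((CHAR('a) choose k) div CHAR('a))) k)"

lemma power_dvd_pderiv:
  fixes a :: "'a::idom poly"
  assumes "a ^ m dvd g"
  shows "a ^ (m - 1) dvd pderiv g"
proof -
  obtain h where g: "g = a ^ m * h" using assms by (elim dvdE)
  show ?thesis
  proof (cases m)
    case (Suc n)
    have "pderiv g = a ^ n * (a * pderiv h + smult (of_nat (Suc n)) (h * pderiv a))"
      unfolding g Suc pderiv_mult pderiv_power_Suc by (simp add: algebra_simps)
    then show ?thesis by (simp add: Suc)
  qed simp
qed

text \<open>Formally, differentiating ((X + 1)^p - X^p - 1) / p cancels the division by p. In
  characteristic p this has to be read off the coefficients, through the absorption identity k (p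
  choose k) / p = (p - 1 choose k - 1).\<close>

lemma pderiv_log_poly:
  assumes "prime CHAR('a::idom)"
  shows "pderiv (log_poly :: 'a poly) = [:1,1:] ^ (CHAR('a) - 1) - monom 1 (CHAR('a) - 1)"
proof (rule poly_eqI)
  fix n
  let ?p = "CHAR('a)"
  have p: "?p > 1" using assms prime_gt_1_nat by blast
  have c: "coeff (log_poly :: 'a poly) k = (if k \<in> {1..<?p} then of_nat ((?p choose k) div ?p) else 0)" for k
    unfolding log_poly_def coeff_sum coeff_monom by (simp add: sum.delta)
  have eq: "of_nat (Suc n) * (of_nat ((?p choose Suc n) div ?p) :: 'a) = of_nat ((?p - 1) choose n)"
    if n: "Suc n < ?p"
  proof -
    have "?p dvd (?p choose Suc n)" using assms n by (intro dvd_choose_prime) auto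
    then have "?p * (Suc n * ((?p choose Suc n) div ?p)) = Suc n * (?p choose Suc n)"
      by (metis dvd_mult_div_cancel mult.left_commute)
    also have "\<dots> = ?p * ((?p - 1) choose n)" using times_binomial_minus1_eq[of "Suc n" ?p] by simp
    finally have "Suc n * ((?p choose Suc n) div ?p) = (?p - 1) choose n" using p by simp
    then show ?thesis by (metis of_nat_mult)
  qed
  consider "Suc n < ?p" | "n = ?p - 1" | "n > ?p - 1" by linarith
  then show "coeff (pderiv (log_poly :: 'a poly)) n =
      coeff ([:1,1:] ^ (?p - 1) - monom 1 (?p - 1)) n"
  proof cases
    case 1
    then show ?thesis unfolding coeff_pderiv c using eq by (simp add: coeff_linear_poly_power)
  next
    case 2
    then show ?thesis unfolding coeff_pderiv c using p by (simp add: coeff_linear_poly_power)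
  next
    case 3
    have "degree ([:1,1::'a:] ^ (?p - 1)) < n" using 3 degree_power_le[of "[:1,1::'a:]" "?p - 1"] by simp
    then show ?thesis unfolding coeff_pderiv c using 3 by (simp add: coeff_eq_0)
  qed
qed

lemma linear_power_CHAR:
  assumes "prime CHAR('a::idom)"
  shows "[:1,1::'a:] ^ CHAR('a) = [:0,1:] ^ CHAR('a) + 1"
proof -
  have "([:0,1::'a:] + 1) ^ CHAR('a) = [:0,1:] ^ CHAR('a) + 1 ^ CHAR('a)"
    using assms by (intro freshmans_dream) auto
  moreover have "[:0,1::'a:] + 1 = [:1,1:]" by (simp add: one_pCons)
  ultimately show ?thesis by simp
qed

text \<open>The freshman's dream turns (X + 1)^p - (X + 1) X^(p - 1) into 1 - X^(p - 1). Modulo X^(p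
  - 1) this is the differential equation of log (1 + X).\<close>

lemma linear_mult_pderiv_log_poly:
  assumes "prime CHAR('a::idom)"
  shows "[:1,1:] * pderiv (log_poly :: 'a poly) = 1 - [:0,1:] ^ (CHAR('a) - 1)"
proof -
  obtain q where q: "CHAR('a) = Suc q" using assms by (metis not0_implies_Suc not_prime_0)
  have "[:1,1:] ^ q * [:1,1::'a:] = [:0,1:] ^ q * [:0,1:] + 1"
    using linear_power_CHAR[OF assms] unfolding q power_Suc by (simp only: mult.commute)
  moreover have "[:1,1::'a:] = [:0,1:] + 1" by (simp add: one_pCons)
  ultimately show ?thesis
    unfolding pderiv_log_poly[OF assms] q monom_altdef
    by (simp add: algebra_simps del: mult_pCons_left mult_pCons_right)
qed

section \<open>Independence of the products (X + 1)^i f^j modulo powers of X\<close>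

text \<open>
  Modulo \<open>X^(p - 1)\<close>, the operator \<open>U d/dX - i0\<close> sends \<open>U^i P(f)\<close> to
  \<open>U^i ((i - i0) P + P')(f)\<close>. It therefore lowers the degree of \<open>P i0\<close>, keeps the degrees
  of the other \<open>P i\<close>, and costs one power of \<open>X\<close>.
\<close>
lemma not_dvd_sum_linear_power_log_poly:
  fixes P :: "nat \<Rightarrow> 'a::field_prime_char poly"
  defines "U \<equiv> [:1,1::'a:]" and "f \<equiv> log_poly :: 'a poly" and "p \<equiv> CHAR('a)"
  assumes "finite I" "I \<noteq> {}" "I \<subseteq> {..<p}" "\<forall>i\<in>I. P i \<noteq> 0"
    and "(\<Sum>i\<in>I. degree (P i) + 1) \<le> m" "m \<le> p"
  shows "\<not> [:0,1:] ^ m dvd (\<Sum>i\<in>I. U ^ i * pcompose (P i) f)"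
  using assms(4-)
proof (induction m arbitrary: I P)
  case 0
  then show ?case by auto
next
  case (Suc m)
  have prim: "prime CHAR('a)" by simp
  obtain i0 where i0: "i0 \<in> I" using Suc.prems by auto
  let ?X = "[:0,1::'a:]"
  define Q where "Q i = smult (of_nat i - of_nat i0) (P i) + pderiv (P i)" for i
  let ?F = "\<Sum>i\<in>I. U ^ i * pcompose (P i) f"
  let ?G = "\<Sum>i\<in>I. U ^ i * pcompose (Q i) f"
  show ?case
  proof
    assume dv: "?X ^ Suc m dvd ?F"
    have inj: "(of_nat i - of_nat i0 :: 'a) \<noteq> 0" if "i \<in> I" "i \<noteq> i0" for i
    proof
      assume "(of_nat i - of_nat i0 :: 'a) = 0"
      then have "[i = i0] (mod p)" by (simp add: p_def of_nat_eq_iff_cong_CHAR)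
      moreover have "i < p" "i0 < p" using that i0 Suc.prems by auto
      ultimately show False using that by (simp add: cong_def)
    qed
    have degp: "degree (P i) < p" if "i \<in> I" for i
    proof -
      have "degree (P i) + 1 \<le> (\<Sum>i\<in>I. degree (P i) + 1)"
        using that Suc.prems(1) by (intro member_le_sum) auto
      then show ?thesis using Suc.prems by linarith
    qed
    have degQ: "degree (Q i) = degree (P i)" "Q i \<noteq> 0" if "i \<in> I" "i \<noteq> i0" for i
    proof -
      have c: "coeff (pderiv (P i)) (degree (P i)) = 0"
        by (simp add: coeff_pderiv coeff_eq_0)
      then have l: "coeff (Q i) (degree (P i)) \<noteq> 0"
        unfolding Q_def using inj[OF that] Suc.prems(4) that by simp
      then show "Q i \<noteq> 0" by auto
      have "degree (Q i) \<le> degree (P i)" unfolding Q_def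
        by (intro degree_add_le degree_smult_le order_trans[OF degree_pderiv_le]) auto
      then show "degree (Q i) = degree (P i)" using l le_degree by (metis le_antisym)
    qed
    have Qi0: "Q i0 = pderiv (P i0)" by (simp add: Q_def)
    \<comment> \<open>In characteristic p a nonconstant polynomial can have derivative zero, but not
      if its degree is below p.\<close>
    have nz: "pderiv (P i0) \<noteq> 0" if "degree (P i0) > 0"
    proof -
      have "coeff (pderiv (P i0)) (degree (P i0) - 1) = of_nat (degree (P i0)) * lead_coeff (P i0)"
        using that by (simp add: coeff_pderiv)
      moreover have "\<not> p dvd degree (P i0)" using that degp[OF i0] by (auto dest: dvd_imp_le)
      ultimately have "coeff (pderiv (P i0)) (degree (P i0) - 1) \<noteq> 0"
        using Suc.prems(4) i0 by (simp add: p_def of_nat_eq_0_iff_char_dvd)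
      then show ?thesis by auto
    qed
    have step: "U * pderiv (U ^ i * pcompose (P i) f) - of_nat i0 * (U ^ i * pcompose (P i) f)
        = U ^ i * pcompose (Q i) f - ?X ^ (p - 1) * (U ^ i * pcompose (pderiv (P i)) f)" for i
    proof -
      have "U * pderiv (U ^ i) = of_nat i * U ^ i"
      proof (cases i)
        case (Suc k)
        have "pderiv U = 1" by (simp add: U_def pderiv_pCons one_pCons)
        then show ?thesis unfolding Suc pderiv_power_Suc by (simp add: of_nat_poly)
      qed simp
      then have "U * pderiv (U ^ i * pcompose (P i) f) = of_nat i * U ^ i * pcompose (P i) f
          + U ^ i * pcompose (pderiv (P i)) f * (U * pderiv f)"
        unfolding pderiv_mult pderiv_pcompose by (simp add: algebra_simps)
      also have "U * pderiv f = 1 - ?X ^ (p - 1)"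
        unfolding U_def f_def p_def by (rule linear_mult_pderiv_log_poly[OF prim])
      finally show ?thesis
        unfolding Q_def pcompose_add pcompose_smult
        by (simp add: algebra_simps of_nat_poly smult_diff_left)
    qed
    have "U * pderiv ?F - of_nat i0 * ?F
        = (\<Sum>i\<in>I. U * pderiv (U ^ i * pcompose (P i) f) - of_nat i0 * (U ^ i * pcompose (P i) f))"
      by (simp add: pderiv_sum sum_distrib_left sum_subtractf)
    also have "\<dots> = ?G - ?X ^ (p - 1) * (\<Sum>i\<in>I. U ^ i * pcompose (pderiv (P i)) f)"
      unfolding step by (simp add: sum_distrib_left sum_subtractf)
    finally have G: "?G = U * pderiv ?F - of_nat i0 * ?F
        + ?X ^ (p - 1) * (\<Sum>i\<in>I. U ^ i * pcompose (pderiv (P i)) f)" by simp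
    have "?X ^ m dvd pderiv ?F" using power_dvd_pderiv[OF dv] by simp
    moreover have "?X ^ m dvd ?F" using dv power_le_dvd[of ?X "Suc m" ?F m] by simp
    \<comment> \<open>The error term of the differential equation is harmless because
      \<open>Suc m\<close> is at most p.\<close>
    moreover have "?X ^ m dvd ?X ^ (p - 1)" using Suc.prems by (intro le_imp_power_dvd) linarith
    ultimately have dG: "?X ^ m dvd ?G" unfolding G by (meson dvd_add dvd_diff dvd_mult dvd_mult2)
    have I: "(\<Sum>i\<in>I. g i) = g i0 + (\<Sum>i\<in>I-{i0}. g i)" for g :: "nat \<Rightarrow> nat"
      using i0 Suc.prems(1) by (rule sum.remove[rotated])
    have sQ: "(\<Sum>i\<in>I-{i0}. degree (Q i) + 1) = (\<Sum>i\<in>I-{i0}. degree (P i) + 1)"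
      by (intro sum.cong) (auto simp: degQ)
    \<comment> \<open>Either \<open>P i0\<close> loses a degree and stays nonzero, or it is constant
      and \<open>i0\<close> leaves the index set. In both cases the sum of \<open>degree + 1\<close>
      drops by at least one.\<close>
    show False
    proof (cases "degree (P i0) = 0")
      case d: False
      have "degree (Q i0) \<le> degree (P i0) - 1" unfolding Qi0 by (rule degree_pderiv_le)
      then have "(\<Sum>i\<in>I. degree (Q i) + 1) \<le> m" "m \<le> p"
        using Suc.prems(5,6) d unfolding I[of "\<lambda>i. degree (Q i) + 1"] I[of "\<lambda>i. degree (P i) + 1"] sQ by auto
      moreover have "\<forall>i\<in>I. Q i \<noteq> 0" using degQ nz d Qi0 by (metis neq0_conv)
      ultimately show False using Suc.IH[of I Q] Suc.prems(1-3) dG by blast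
    next
      case d: True
      then have Q0: "Q i0 = 0" unfolding Qi0 by (auto elim!: degree_eq_zeroE simp: pderiv_pCons)
      show False
      proof (cases "I = {i0}")
        case True
        \<comment> \<open>Only a nonzero constant times a power of U is left, and U takes the value
          1 at 0.\<close>
        have "?X dvd ?F" using dv by (meson dvd_power_same dvd_trans dvd_power zero_less_Suc)
        then have "poly ?F 0 = 0" by (auto elim!: dvdE)
        then show False using True d Suc.prems(4) i0
          by (auto elim!: degree_eq_zeroE simp: U_def)
      next
        case False
        have "?G = (\<Sum>i\<in>I-{i0}. U ^ i * pcompose (Q i) f)"
          using Q0 sum.remove[OF Suc.prems(1) i0, of "\<lambda>i. U ^ i * pcompose (Q i) f"] by simp
        moreover have "(\<Sum>i\<in>I-{i0}. degree (Q i) + 1) \<le> m" "m \<le> p"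
          using Suc.prems(5,6) unfolding I[of "\<lambda>i. degree (P i) + 1"] sQ by auto
        moreover have "\<forall>i\<in>I-{i0}. Q i \<noteq> 0" using degQ by auto
        moreover have "I - {i0} \<noteq> {}" using False i0 by auto
        moreover have "finite (I - {i0})" "I - {i0} \<subseteq> {..<p}" using Suc.prems(1,3) by auto
        ultimately show False using Suc.IH[of "I - {i0}" Q] dG by simp
      qed
    qed
  qed
qed

section \<open>The derivation X (X + 1) d/dX and orders of vanishing\<close>

text \<open>The factor X turns 1 - X^(p - 1) into X - X^p, which is a combination of the products
  \<open>aux_monom\<close>, so their span is stable. Away from 0 and -1 the factor X (X + 1) does
  not affect orders of vanishing.\<close>

definition euler_deriv :: "'a::idom poly \<Rightarrow> 'a poly" where
  "euler_deriv g = [:0,1:] * ([:1,1:] * pderiv g)"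

lemma euler_deriv_add: "euler_deriv (g + h) = euler_deriv g + euler_deriv h"
  by (simp add: euler_deriv_def pderiv_add algebra_simps del: mult_pCons_left mult_pCons_right)

lemma euler_deriv_smult: "euler_deriv (smult c g) = smult c (euler_deriv g)"
  by (simp add: euler_deriv_def pderiv_smult del: mult_pCons_left mult_pCons_right)

lemma euler_deriv_funpow_sum:
  "(euler_deriv ^^ n) (\<Sum>i\<in>I. smult (c i) (g i)) = (\<Sum>i\<in>I. smult (c i) ((euler_deriv ^^ n) (g i)))"
proof (induction n)
  case (Suc n)
  have "euler_deriv (\<Sum>i\<in>I. h i) = (\<Sum>i\<in>I. euler_deriv (h i))" for h :: "'b \<Rightarrow> 'a poly"
    by (induction I rule: infinite_finite_induct) (simp_all add: euler_deriv_add, simp_all add: euler_deriv_def)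
  then show ?case by (simp add: Suc euler_deriv_smult)
qed simp

lemma linear_power_dvd_mult_cancel:
  fixes x :: "'a::idom"
  assumes "[:-x,1:] ^ n dvd q * h" "poly q x \<noteq> 0"
  shows "[:-x,1:] ^ n dvd h"
proof (cases "h = 0")
  case False
  have "q \<noteq> 0" using assms(2) by auto
  moreover have "order x q = 0" using assms(2) by (rule order_0I)
  ultimately show ?thesis using assms(1) False by (simp add: order_divides order_mult)
qed simp

text \<open>Induction on the order: if g = (X - x)^D H and (X - x)^D divides the derivative of g,
  then D (X - x)^(D - 1) H is divisible by (X - x)^D. Since D < p is invertible, H vanishes at
  x.\<close>

lemma linear_power_dvd_if_iterates_vanish:
  fixes x :: "'a::field_prime_char"
  assumes "x \<noteq> 0" "x \<noteq> -1" "D \<le> CHAR('a)" "\<And>n. n < D \<Longrightarrow> poly ((euler_deriv ^^ n) g) x = 0"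
  shows "[:-x,1:] ^ D dvd g"
  using assms(3,4)
proof (induction D arbitrary: g)
  case (Suc D)
  let ?L = "[:-x,1:]"
  have "?L ^ D dvd euler_deriv g"
  proof (rule Suc.IH)
    show "poly ((euler_deriv ^^ n) (euler_deriv g)) x = 0" if "n < D" for n
      using Suc.prems(2)[of "Suc n"] that by (simp add: funpow_swap1)
  qed (use Suc.prems in simp)
  moreover have "poly ([:0,1:] * [:1,1:]) x \<noteq> 0"
    using assms(1,2) by (auto simp: add_eq_0_iff add.commute)
  ultimately have dd: "?L ^ D dvd pderiv g"
    unfolding euler_deriv_def mult.assoc[symmetric] by (rule linear_power_dvd_mult_cancel)
  have "?L ^ D dvd g" using Suc by simp
  then obtain H where g: "g = ?L ^ D * H" by (elim dvdE)
  have "poly H x = 0"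
  proof (cases D)
    case 0
    then show ?thesis using Suc.prems(2)[of 0] g by simp
  next
    case (Suc e)
    have "pderiv g = ?L ^ D * pderiv H + ?L ^ e * smult (of_nat D) H"
      unfolding g Suc pderiv_mult pderiv_power_Suc by (simp add: pderiv_pCons algebra_simps)
    then have "?L ^ e * ?L dvd ?L ^ e * smult (of_nat D) H"
      using dd Suc by (simp add: dvd_add_right_iff mult.commute)
    moreover have "?L ^ e \<noteq> 0" by simp
    ultimately have "?L dvd smult (of_nat D) H" using dvd_mult_cancel_left by blast
    moreover have "(of_nat D :: 'a) \<noteq> 0"
      unfolding of_nat_eq_0_iff_char_dvd using Suc.prems(1) Suc by (auto dest: dvd_imp_le)
    ultimately show ?thesis by (metis poly_eq_0_iff_dvd poly_smult mult_eq_0_iff)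
  qed
  then have "?L dvd H" by (simp add: poly_eq_0_iff_dvd)
  then show ?case unfolding g power_Suc2 by (rule mult_dvd_mono[OF dvd_refl])
qed simp

section \<open>The auxiliary products and their values at the roots\<close>

text \<open>The factor X^(pk) has derivative zero and the value x^k on the prime field. It supplies
  many products of high degree whose values have low degree.\<close>

definition aux_monom :: "nat \<Rightarrow> nat \<Rightarrow> nat \<Rightarrow> 'a::idom poly" where
  "aux_monom i j k = [:1,1:] ^ i * log_poly ^ j * [:0,1:] ^ (CHAR('a) * k)"

text \<open>With U = X + 1, the derivation sends U^i to i X U^i, f^j to j f^(j - 1) (X - X^p) and
  X^(pk) to 0; then X is replaced by U - 1. For j = 0 the truncated \<open>j - 1\<close> only occurs
  with coefficient 0.\<close>

lemma euler_deriv_aux_monom: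
  assumes "prime CHAR('a::idom)"
  shows "euler_deriv (aux_monom i j k :: 'a poly) =
    smult (of_nat i) (aux_monom (i + 1) j k) + (smult (- of_nat i) (aux_monom i j k)
    + (smult (of_nat j) (aux_monom (i + 1) (j - 1) k) + (smult (- of_nat j) (aux_monom i (j - 1) k)
    + smult (- of_nat j) (aux_monom i (j - 1) (k + 1)))))"
proof -
  define X U f where "X = [:0,1::'a:]" and "U = [:1,1::'a:]" and "f = (log_poly :: 'a poly)"
  define Y where "Y = X ^ CHAR('a)"
  have dX: "pderiv X = 1" and dU: "pderiv U = 1" and UX: "U = X + 1"
    by (simp_all add: X_def U_def pderiv_pCons one_pCons)
  have "X * (U * pderiv f) = X * (1 - X ^ (CHAR('a) - 1))"
    using linear_mult_pderiv_log_poly[OF assms] by (simp only: X_def U_def f_def)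
  also have "\<dots> = X - Y"
    using assms prime_gt_0_nat[OF assms] unfolding Y_def by (simp add: right_diff_distrib power_eq_if)
  finally have f: "X * (U * pderiv f) = X - Y" .
  have dp: "V * pderiv (V ^ n) = of_nat n * V ^ n" if "pderiv V = 1" for V :: "'a poly" and n
  proof (cases n)
    case (Suc m)
    show ?thesis unfolding Suc pderiv_power_Suc that by (simp add: of_nat_poly)
  qed simp
  have dpf: "pderiv (f ^ j) = of_nat j * f ^ (j - 1) * pderiv f"
  proof (cases j)
    case (Suc m)
    show ?thesis unfolding Suc pderiv_power_Suc by (simp add: of_nat_poly)
  qed simp
  have dY: "pderiv (Y ^ k) = 0"
  proof -
    have "(of_nat CHAR('a) :: 'a poly) = 0" by (simp add: of_nat_poly)
    then have "X * pderiv (Y ^ k) = 0"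
      using dp[OF dX, of "CHAR('a) * k"] unfolding Y_def power_mult[symmetric] by simp
    then show ?thesis by (simp add: X_def)
  qed
  have "euler_deriv (U ^ i * f ^ j * Y ^ k) =
      X * (U * pderiv (U ^ i)) * f ^ j * Y ^ k + U ^ i * (of_nat j * f ^ (j - 1)) * (X * (U * pderiv f)) * Y ^ k"
    unfolding euler_deriv_def X_def[symmetric] U_def[symmetric] pderiv_mult dY dpf
    by (simp add: algebra_simps)
  also have "\<dots> = of_nat i * X * U ^ i * f ^ j * Y ^ k + of_nat j * U ^ i * f ^ (j - 1) * (X - Y) * Y ^ k"
    unfolding f dp[OF dU] by (simp add: algebra_simps)
  also have "\<dots> = of_nat i * (U ^ (i + 1) * f ^ j * Y ^ k) + (- of_nat i * (U ^ i * f ^ j * Y ^ k)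
      + (of_nat j * (U ^ (i + 1) * f ^ (j - 1) * Y ^ k) + (- of_nat j * (U ^ i * f ^ (j - 1) * Y ^ k)
      + - of_nat j * (U ^ i * f ^ (j - 1) * Y ^ (k + 1)))))"
    unfolding UX by (simp add: algebra_simps)
  finally show ?thesis
    unfolding aux_monom_def X_def[symmetric] U_def[symmetric] f_def[symmetric] power_mult Y_def[symmetric]
    by (simp add: of_nat_poly)
qed

text \<open>The filtration by the weight i + j + k. The inductive form lets both the action of the
  derivation and the evaluation at roots be proved one product at a time.\<close>

inductive_set aux_span :: "nat \<Rightarrow> 'a::idom poly set" for d where
  aux_span_monom: "i + j + k \<le> d \<Longrightarrow> smult c (aux_monom i j k) \<in> aux_span d"
| aux_span_add: "g \<in> aux_span d \<Longrightarrow> h \<in> aux_span d \<Longrightarrow> g + h \<in> aux_span d"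

lemma euler_deriv_aux_span:
  assumes "prime CHAR('a::idom)" "(g :: 'a poly) \<in> aux_span d"
  shows "euler_deriv g \<in> aux_span (Suc d)"
  using assms(2)
proof induction
  case (aux_span_monom i j k c)
  then show ?case
    unfolding euler_deriv_smult euler_deriv_aux_monom[OF assms(1)] smult_add_right smult_smult
    by (intro aux_span.intros) auto
qed (simp add: euler_deriv_add aux_span_add)

lemma euler_deriv_funpow_aux_span:
  assumes "prime CHAR('a::idom)"
  shows "(euler_deriv ^^ n) (aux_monom i j k :: 'a poly) \<in> aux_span (i + j + k + n)"
proof (induction n)
  case 0
  show ?case using aux_span_monom[of i j k "i + j + k" 1] by simp
qed (use euler_deriv_aux_span[OF assms] in simp)

text \<open>At a root of f the products with j > 0 vanish, and x^p = x reduces the others to (x +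
  1)^i x^k. One polynomial serves all the roots at once.\<close>

lemma aux_span_eval:
  assumes "(g :: 'a::idom poly) \<in> aux_span d"
  shows "\<exists>q. degree q \<le> d \<and> (\<forall>x. x ^ CHAR('a) = x \<longrightarrow> poly log_poly x = 0 \<longrightarrow> poly g x = poly q x)"
  using assms
proof induction
  case (aux_span_monom i j k c)
  show ?case
  proof (cases "j = 0")
    case True
    have "degree ([:1,1:] ^ i * [:0,1:] ^ k :: 'a poly) \<le> i + k"
      by (rule order_trans[OF degree_mult_le add_mono]) (rule order_trans[OF degree_power_le], simp)+
    then have "degree (smult c ([:1,1:] ^ i * [:0,1:] ^ k)) \<le> d"
      using aux_span_monom by (intro order_trans[OF degree_smult_le]) simp
    then show ?thesis using True
      by (intro exI[of _ "smult c ([:1,1:] ^ i * [:0,1:] ^ k)"]) (auto simp: aux_monom_def power_mult)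
  next
    case False
    then show ?thesis by (intro exI[of _ 0]) (auto simp: aux_monom_def)
  qed
next
  case (aux_span_add g h)
  then obtain q r where "degree q \<le> d" "degree r \<le> d"
    "\<forall>x. x ^ CHAR('a) = x \<longrightarrow> poly log_poly x = 0 \<longrightarrow> poly g x = poly q x"
    "\<forall>x. x ^ CHAR('a) = x \<longrightarrow> poly log_poly x = 0 \<longrightarrow> poly h x = poly r x" by blast
  then show ?case by (intro exI[of _ "q + r"]) (auto intro: degree_add_le)
qed

section \<open>Construction of the auxiliary polynomial\<close>

text \<open>Pigeonhole over a finite field: there are more coefficient vectors than right-hand
  sides, so two vectors have the same image, and their difference is a solution.\<close>

lemma homogeneous_system_nontrivial_solution:
  fixes c :: "'i \<Rightarrow> 'j \<Rightarrow> 'a::{finite,idom}"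
  assumes "finite I" "finite J" "card J < card I"
  shows "\<exists>a. (\<exists>i\<in>I. a i \<noteq> 0) \<and> (\<forall>j\<in>J. (\<Sum>i\<in>I. a i * c i j) = 0)"
proof -
  define F where "F a = restrict (\<lambda>j. \<Sum>i\<in>I. a i * c i j) J" for a
  have "CARD('a) > 1" using card_mono[of UNIV "{0,1::'a}"] by simp
  then have "CARD('a) ^ card J < CARD('a) ^ card I"
    using assms(3) by (rule power_strict_increasing[rotated])
  moreover have "card (F ` (I \<rightarrow>\<^sub>E UNIV)) \<le> card (J \<rightarrow>\<^sub>E (UNIV :: 'a set))"
  proof (rule card_mono)
    show "F ` (I \<rightarrow>\<^sub>E UNIV) \<subseteq> (J \<rightarrow>\<^sub>E UNIV)" by (auto simp: F_def)
  qed (simp add: assms(2) finite_PiE)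
  ultimately have "card (F ` (I \<rightarrow>\<^sub>E UNIV)) < card (I \<rightarrow>\<^sub>E (UNIV :: 'a set))"
    using assms(1,2) by (simp add: card_PiE)
  then have "\<not> inj_on F (I \<rightarrow>\<^sub>E UNIV)" by (rule pigeonhole)
  then obtain a b where ab: "a \<in> I \<rightarrow>\<^sub>E UNIV" "b \<in> I \<rightarrow>\<^sub>E UNIV" "a \<noteq> b" "F a = F b"
    by (auto simp: inj_on_def)
  have "\<exists>i\<in>I. a i - b i \<noteq> 0"
  proof (rule ccontr)
    assume "\<not> ?thesis"
    then have "a = b" by (intro PiE_ext[OF ab(1,2)]) simp
    then show False using ab(3) by simp
  qed
  moreover have "(\<Sum>i\<in>I. (a i - b i) * c i j) = 0" if "j \<in> J" for j
    using fun_cong[OF ab(4), of j] that by (simp add: F_def left_diff_distrib sum_subtractf)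
  ultimately show ?thesis by (intro exI[of _ "\<lambda>i. a i - b i"] conjI ballI)
qed

definition aux_poly :: "nat \<Rightarrow> nat \<Rightarrow> nat \<Rightarrow> (nat \<times> nat \<times> nat \<Rightarrow> 'a) \<Rightarrow> 'a::idom poly" where
  "aux_poly A B C a = (\<Sum>(i,j,k)\<in>{..<A} \<times> {..<B} \<times> {..<C}. smult (a (i, j, k)) (aux_monom i j k))"

text \<open>For each n < D the values at the roots come from one polynomial of degree below A + B +
  C + D. Making all its coefficients zero costs D (A + B + C + D) equations in A B C unknowns,
  however many roots there are.\<close>

lemma aux_poly_exists:
  fixes A B C D :: nat
  assumes "D * (A + B + C + D) < A * B * C" "CARD('a::finite_field) = CHAR('a)"
  obtains a :: "_ \<Rightarrow> 'a::finite_field" where "\<exists>t\<in>{..<A} \<times> {..<B} \<times> {..<C}. a t \<noteq> 0"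
    "\<And>x n. poly log_poly x = 0 \<Longrightarrow> n < D \<Longrightarrow> poly ((euler_deriv ^^ n) (aux_poly A B C a)) x = 0"
proof -
  let ?I = "{..<A} \<times> {..<B} \<times> {..<C}"
  have frob: "x ^ CHAR('a) = x" for x :: 'a
    using finite_field_power_card_eq_same[of x] assms(2) by simp
  define R where "R t n q \<longleftrightarrow> degree q \<le> fst t + fst (snd t) + snd (snd t) + n \<and>
      (\<forall>x. poly log_poly x = 0 \<longrightarrow>
        poly ((euler_deriv ^^ n) (aux_monom (fst t) (fst (snd t)) (snd (snd t)))) x = poly q x)"
    for t n and q :: "'a poly"
  have ex: "\<exists>q. R t n q" for t n
    using aux_span_eval[OF euler_deriv_funpow_aux_span[where ?'a = 'a,
        of n "fst t" "fst (snd t)" "snd (snd t)"]] frob unfolding R_def by simp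
  \<comment> \<open>Fixing one polynomial per product and per n makes the conditions on
    \<open>a\<close> linear.\<close>
  define q where "q t n = (SOME q. R t n q)" for t n
  have q: "R t n (q t n)" for t n
    unfolding q_def by (rule someI_ex[OF ex])
  have "card ({..<D} \<times> {..<A + B + C + D}) < card ?I"
    using assms(1) by (simp add: card_cartesian_product algebra_simps)
  from homogeneous_system_nontrivial_solution[OF _ _ this, of "\<lambda>t (n, e). coeff (q t n) e"]
  obtain a where a: "\<exists>t\<in>?I. a t \<noteq> 0"
    "\<And>n e. n < D \<Longrightarrow> e < A + B + C + D \<Longrightarrow> (\<Sum>t\<in>?I. a t * coeff (q t n) e) = 0" by auto
  have "poly ((euler_deriv ^^ n) (aux_poly A B C a)) x = 0" if x: "poly log_poly x = 0" and n: "n < D" for x n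
  proof -
    have "(\<Sum>t\<in>?I. smult (a t) (q t n)) = 0"
    proof (rule poly_eqI)
      fix e
      show "coeff (\<Sum>t\<in>?I. smult (a t) (q t n)) e = coeff 0 e"
      proof (cases "e < A + B + C + D")
        case True
        then show ?thesis using a(2)[OF n] by (simp add: coeff_sum)
      next
        case False
        have "coeff (q t n) e = 0" if "t \<in> ?I" for t
          using q[of t n] that n False unfolding R_def by (intro coeff_eq_0) auto
        then show ?thesis by (simp add: coeff_sum)
      qed
    qed
    moreover have "poly ((euler_deriv ^^ n) (aux_poly A B C a)) x = poly (\<Sum>t\<in>?I. smult (a t) (q t n)) x"
      unfolding aux_poly_def case_prod_unfold euler_deriv_funpow_sum poly_sum poly_smult
      using q x by (simp add: R_def)
    ultimately show ?thesis by simp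
  qed
  with a(1) show ?thesis by (rule that)
qed

section \<open>Degree and nonvanishing of the auxiliary polynomial\<close>

lemma degree_log_poly_le: "degree (log_poly :: 'a::comm_ring_1 poly) \<le> CHAR('a)"
  unfolding log_poly_def by (intro degree_sum_le) (auto intro: order_trans[OF degree_monom_le])

lemma degree_aux_poly_le:
  fixes a :: "_ \<Rightarrow> 'a::idom"
  assumes "A \<le> CHAR('a)"
  shows "degree (aux_poly A B C a) \<le> (B + C) * CHAR('a)"
proof -
  let ?p = "CHAR('a)"
  have "degree (aux_monom i j k :: 'a poly) \<le> (B + C) * ?p" if "i < A" "j < B" "k < C" for i j k
  proof -
    have "degree (aux_monom i j k :: 'a poly) \<le> i + ?p * j + ?p * k"
      unfolding aux_monom_def
      by (intro order_trans[OF degree_mult_le add_mono] order_trans[OF degree_power_le])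
        (auto simp: degree_log_poly_le)
    \<comment> \<open>As i < A <= p, one extra multiple of p absorbs i.\<close>
    also have "\<dots> \<le> ?p * (1 + j + k)" using that assms by (simp add: algebra_simps)
    also have "\<dots> \<le> ?p * (B + C)" using that by (intro mult_left_mono) auto
    finally show ?thesis by (simp add: mult.commute)
  qed
  then show ?thesis
    unfolding aux_poly_def
    by (intro degree_sum_le) (auto intro: order_trans[OF degree_smult_le])
qed

lemma pcompose_monom_eq_smult: "pcompose (monom c n) q = smult c (q ^ n)"
  for q :: "'a::comm_ring_1 poly"
  by (induction n) (simp_all add: monom_0 monom_Suc pcompose_pCons)

text \<open>Group the sum by powers of X^p. If it were zero, the lowest block with a nonzero
  coefficient would be divisible by X^p, because all later blocks carry a further factor X^p. This
  contradicts independence, as the block has at most A B <= p coefficients.\<close>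

lemma aux_poly_nonzero:
  fixes a :: "_ \<Rightarrow> 'a::field_prime_char"
  assumes "A * B \<le> CHAR('a)" "\<exists>t\<in>{..<A} \<times> {..<B} \<times> {..<C}. a t \<noteq> 0"
  shows "aux_poly A B C a \<noteq> 0"
proof
  assume 0: "aux_poly A B C a = 0"
  let ?p = "CHAR('a)"
  let ?X = "[:0,1::'a:]"
  define P where "P k i = (\<Sum>j<B. monom (a (i, j, k)) j)" for k i
  have coeffP: "coeff (P k i) j = (if j < B then a (i, j, k) else 0)" for k i j
    by (simp add: P_def coeff_sum)
  define G where "G k = (\<Sum>i<A. [:1,1:] ^ i * pcompose (P k i) log_poly)" for k
  have P: "pcompose (P k i) log_poly = (\<Sum>j<B. smult (a (i, j, k)) (log_poly ^ j))" for k i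
    unfolding P_def pcompose_sum by (simp add: pcompose_monom_eq_smult)
  have "aux_poly A B C a = (\<Sum>i<A. \<Sum>j<B. \<Sum>k<C. smult (a (i, j, k)) (aux_monom i j k))"
    unfolding aux_poly_def by (simp add: sum.cartesian_product)
  also have "\<dots> = (\<Sum>i<A. \<Sum>k<C. \<Sum>j<B. smult (a (i, j, k)) (aux_monom i j k))"
    by (intro sum.cong refl sum.swap)
  also have "\<dots> = (\<Sum>k<C. \<Sum>i<A. \<Sum>j<B. smult (a (i, j, k)) (aux_monom i j k))"
    by (rule sum.swap)
  also have "\<dots> = (\<Sum>k<C. ?X ^ (?p * k) * G k)"
  proof (rule sum.cong[OF refl])
    fix k
    have "smult c (u * v * w) = w * (u * smult c v)" for c and u v w :: "'a poly"
      by (simp add: mult_ac)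
    then show "(\<Sum>i<A. \<Sum>j<B. smult (a (i, j, k)) (aux_monom i j k)) = ?X ^ (?p * k) * G k"
      unfolding G_def P aux_monom_def sum_distrib_left by (intro sum.cong refl)
  qed
  finally have sum0: "(\<Sum>k<C. ?X ^ (?p * k) * G k) = 0" using 0 by simp
  define k0 where "k0 = (LEAST k. k < C \<and> (\<exists>i<A. P k i \<noteq> 0))"
  obtain i j k where ijk: "i < A" "j < B" "k < C" "a (i, j, k) \<noteq> 0" using assms(2) by auto
  then have "P k i \<noteq> 0" using coeffP[of k i j] by auto
  then have k0: "k0 < C" "\<exists>i<A. P k0 i \<noteq> 0"
    using LeastI[of "\<lambda>k. k < C \<and> (\<exists>i<A. P k i \<noteq> 0)" k] ijk unfolding k0_def by auto
  have less: "G k = 0" if "k < k0" for k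
    using not_less_Least[OF that[unfolded k0_def]] that k0(1) by (auto simp: G_def)
  have "?X ^ (?p * k0 + ?p) dvd ?X ^ (?p * k) * G k" if "k \<in> {..<C} - {k0}" for k
  proof (cases "k < k0")
    case False
    then have "?p * (k0 + 1) \<le> ?p * k" using that by (intro mult_left_mono) auto
    then show ?thesis by (intro dvd_mult2 le_imp_power_dvd) simp
  qed (simp add: less)
  then have rest: "?X ^ (?p * k0 + ?p) dvd (\<Sum>k\<in>{..<C} - {k0}. ?X ^ (?p * k) * G k)"
    by (rule dvd_sum)
  have "(\<Sum>k<C. ?X ^ (?p * k) * G k) =
      ?X ^ (?p * k0) * G k0 + (\<Sum>k\<in>{..<C} - {k0}. ?X ^ (?p * k) * G k)"
    using k0 by (intro sum.remove) auto
  then have "?X ^ (?p * k0) * G k0 = - (\<Sum>k\<in>{..<C} - {k0}. ?X ^ (?p * k) * G k)"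
    unfolding sum0 by (simp only: eq_neg_iff_add_eq_0)
  then have "?X ^ (?p * k0 + ?p) dvd ?X ^ (?p * k0) * G k0"
    using rest by (simp only: dvd_minus_iff)
  then have dG: "?X ^ ?p dvd G k0" by (simp add: power_add)
  \<comment> \<open>The independence lemma wants every \<open>P k0 i\<close> nonzero, so the zero
    ones are dropped.\<close>
  define I where "I = {i. i < A \<and> P k0 i \<noteq> 0}"
  have G: "G k0 = (\<Sum>i\<in>I. [:1,1:] ^ i * pcompose (P k0 i) log_poly)"
    unfolding G_def by (intro sum.mono_neutral_right) (auto simp: I_def)
  have "degree (P k0 i) + 1 \<le> B" for i
  proof -
    have "degree (P k0 i) \<le> B - 1" by (intro degree_le) (auto simp: coeffP)
    then show ?thesis using ijk by simp
  qed
  then have "(\<Sum>i\<in>I. degree (P k0 i) + 1) \<le> (\<Sum>i\<in>I. B)" by (intro sum_mono)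
  also have "\<dots> = card I * B" by simp
  also have "\<dots> \<le> A * B" using card_mono[of "{..<A}" I] by (intro mult_right_mono) (auto simp: I_def)
  finally have "(\<Sum>i\<in>I. degree (P k0 i) + 1) \<le> ?p" using assms(1) by simp
  moreover have "A \<le> A * B" using ijk by simp
  then have "A \<le> ?p" using assms(1) by (rule le_trans)
  then have "I \<subseteq> {..<?p}" by (auto simp: I_def)
  moreover have "finite I" "I \<noteq> {}" "\<forall>i\<in>I. P k0 i \<noteq> 0" using k0 by (auto simp: I_def)
  ultimately show False
    using not_dvd_sum_linear_power_log_poly[of I "P k0" ?p] dG unfolding G by blast
qed

section \<open>Counting the roots\<close>

lemma card_mult_le_degree:
  fixes g :: "'a::idom poly"
  assumes "g \<noteq> 0" "\<And>x. x \<in> S \<Longrightarrow> [:-x,1:] ^ D dvd g" "D > 0"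
  shows "card S * D \<le> degree g"
proof -
  have "S \<subseteq> {x. poly g x = 0}"
  proof
    fix x assume "x \<in> S"
    then have "[:-x,1:] dvd g" using assms(2,3) dvd_power dvd_trans by blast
    then show "x \<in> {x. poly g x = 0}" by (simp add: poly_eq_0_iff_dvd)
  qed
  then have S: "S \<subseteq> set_mset (proots g)" using assms(1) by simp
  have "card S * D = (\<Sum>x\<in>S. D)" by simp
  also have "\<dots> \<le> (\<Sum>x\<in>S. count (proots g) x)"
    using assms(1,2) by (intro sum_mono) (simp add: order_divides)
  also have "\<dots> \<le> (\<Sum>x\<in>set_mset (proots g). count (proots g) x)"
    using S by (intro sum_mono2) auto
  also have "\<dots> \<le> degree g" using size_proots_le[of g] by (simp add: size_multiset_overloaded_eq)
  finally show ?thesis .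
qed

lemma card_log_poly_roots:
  fixes c :: nat
  assumes "CARD('a::finite_field) = CHAR('a)" "c > 0" "8 * c ^ 3 \<le> CHAR('a)"
  shows "card {x :: 'a. x \<noteq> 0 \<and> x \<noteq> -1 \<and> poly log_poly x = 0} * c \<le> 4 * CHAR('a)"
    (is "card ?S * c \<le> _")
proof -
  let ?p = "CHAR('a)"
  \<comment> \<open>A B = 8 c^3 <= p gives nonvanishing. The unknowns number 16 c^4, against c^2 (5
    c^2 + 4 c) <= 9 c^4 equations. Degree 4 c p against order c^2 leaves at most 4 p / c
    roots.\<close>
  define A B D where "A = 4 * c ^ 2" and "B = 2 * c" and "D = c ^ 2"
  have AB: "A * B \<le> ?p" using assms(3) by (simp add: A_def B_def power2_eq_square power3_eq_cube)
  have cc: "c \<le> c ^ 2" using assms(2) by (simp add: power2_eq_square)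
  have "A + B + B + D < 16 * c ^ 2"
    using cc assms(2) unfolding A_def B_def D_def by simp
  then have "D * (A + B + B + D) < D * (16 * c ^ 2)"
    using assms(2) unfolding D_def by (intro mult_strict_left_mono) auto
  also have "\<dots> = A * B * B" unfolding A_def B_def D_def by (simp add: power2_eq_square)
  finally obtain a :: "_ \<Rightarrow> 'a" where a: "\<exists>t\<in>{..<A} \<times> {..<B} \<times> {..<B}. a t \<noteq> 0"
    "\<And>x n. poly log_poly x = 0 \<Longrightarrow> n < D \<Longrightarrow> poly ((euler_deriv ^^ n) (aux_poly A B B a)) x = 0"
    using aux_poly_exists[OF _ assms(1)] by metis
  have "A \<le> A * B" using assms(2) by (simp add: B_def)
  then have A: "A \<le> ?p" using AB by (rule le_trans)
  have "[:-x,1:] ^ D dvd aux_poly A B B a" if "x \<in> ?S" for x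
    using that a(2) A by (intro linear_power_dvd_if_iterates_vanish) (auto simp: A_def D_def)
  then have "card ?S * D \<le> degree (aux_poly A B B a)"
    using aux_poly_nonzero[OF AB a(1)] assms(2) by (intro card_mult_le_degree) (auto simp: D_def)
  also have "\<dots> \<le> (B + B) * ?p" by (rule degree_aux_poly_le[OF A])
  finally have "(card ?S * c) * c \<le> (4 * ?p) * c" by (simp add: B_def D_def power2_eq_square mult_ac)
  then show ?thesis using assms(2) by simp
qed

section \<open>From vanishing symbols to roots\<close>

lemma sum_binomial_div_prime:
  fixes p s :: nat
  assumes "prime p"
  shows "p * (\<Sum>k=1..<p. (p choose k) div p * s ^ k) + s ^ p + 1 = (s + 1) ^ p"
proof -
  have p: "p > 0" using assms prime_gt_0_nat by blast
  have set: "{..p} = insert 0 (insert p {1..<p})" by auto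
  have "(s + 1) ^ p = (\<Sum>k\<le>p. (p choose k) * s ^ k)"
    using binomial[of s 1 p] by simp
  also have "\<dots> = 1 + (s ^ p + (\<Sum>k=1..<p. (p choose k) * s ^ k))"
    unfolding set using p by simp
  also have "(\<Sum>k=1..<p. (p choose k) * s ^ k) = (\<Sum>k=1..<p. p * ((p choose k) div p * s ^ k))"
  proof (rule sum.cong[OF refl])
    fix k assume "k \<in> {1..<p}"
    then have "p dvd (p choose k)" using assms by (intro dvd_choose_prime) auto
    then show "(p choose k) * s ^ k = p * ((p choose k) div p * s ^ k)" by (simp flip: mult.assoc)
  qed
  finally show ?thesis by (simp add: sum_distrib_left)
qed

lemma poly_log_poly_of_nat:
  "poly (log_poly :: 'a::comm_ring_1 poly) (of_nat s) =
    of_nat (\<Sum>k=1..<CHAR('a). (CHAR('a) choose k) div CHAR('a) * s ^ k)"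
  by (simp add: log_poly_def poly_sum poly_monom)

text \<open>For u prime to p, u^p = u + p u k with k congruent to the Fermat quotient of u.
  Inserting u = s and u = s + 1 into (s + 1)^p - s^p - 1 and dividing by p gives, modulo p, the
  negative of s q_p(s) - (s + 1) q_p(s + 1). The other factors under the Legendre symbol are
  units.\<close>

lemma vartheta_eq_0_imp_dvd:
  assumes "prime p" "s \<in> {1..p - 2}" "vartheta p s = 0"
  shows "p dvd (\<Sum>k=1..<p. (p choose k) div p * s ^ k)"
proof -
  let ?p = "int p"
  let ?m = "\<Sum>k=1..<p. (p choose k) div p * s ^ k"
  let ?v = "fermat_quotient_rat p (of_nat s ^ s / of_nat (s + 1) ^ (s + 1))"
  have p: "prime ?p" "p > 0" using assms(1) by (auto simp: prime_gt_0_nat)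
  \<comment> \<open>For p = 2 the range of s is empty, so p is at least 3 here.\<close>
  have nd: "\<not> p dvd 2" "\<not> p dvd s" "\<not> p dvd s + 1" using assms(2) by (auto dest!: dvd_imp_le)
  then have ndi: "\<not> ?p dvd 2" "\<not> ?p dvd int s" "\<not> ?p dvd int s + 1"
    by (metis int_dvd_int_iff of_nat_numeral of_nat_1 of_nat_add)+
  have "?p dvd 2 * int s * (int s + 1) * ?v"
    using assms(3) by (auto simp: vartheta_def Legendre_def cong_0_iff split: if_splits)
  then have "?p dvd ?v" using ndi p(1) by (simp add: prime_dvd_mult_iff)
  then have dv: "?p dvd int s * fermat_quotient p (int s) - (int s + 1) * fermat_quotient p (int s + 1)"
    using fermat_quotient_rat_self_power[OF assms(1,2)] by (simp add: cong_dvd_iff)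
  have q: "\<exists>k. u ^ p = u + ?p * (u * k) \<and> [fermat_quotient p u = k] (mod ?p)" if "\<not> ?p dvd u" for u
  proof -
    have "coprime u ?p" using that p(1) by (metis coprime_commute prime_imp_coprime)
    then obtain k where k: "u ^ (p - 1) - 1 = ?p * k"
      using fermat_quotient_dvd[OF assms(1)] by (auto simp: dvd_def)
    have "u ^ p = u * u ^ (p - 1)" using p(2) by (simp add: power_eq_if)
    also have "u ^ (p - 1) = 1 + ?p * k" using k by simp
    finally have "u ^ p = u + ?p * (u * k)" by (simp add: algebra_simps)
    moreover have "[fermat_quotient p u = k] (mod ?p)"
      using fermat_quotient_eq_mod[OF _ k] p(2) by (simp add: cong_def)
    ultimately show ?thesis by blast
  qed
  obtain k where k: "int s ^ p = int s + ?p * (int s * k)" "[fermat_quotient p (int s) = k] (mod ?p)"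
    using q[OF ndi(2)] by blast
  obtain l where l: "(int s + 1) ^ p = int s + 1 + ?p * ((int s + 1) * l)"
      "[fermat_quotient p (int s + 1) = l] (mod ?p)"
    using q[OF ndi(3)] by blast
  have "?p * int ?m + int s ^ p + 1 = (int s + 1) ^ p"
    using arg_cong[OF sum_binomial_div_prime[OF assms(1), of s], of int]
    by (simp only: of_nat_add of_nat_mult of_nat_power of_nat_1)
  then have "?p * int ?m = ?p * ((int s + 1) * l - int s * k)"
    unfolding k(1) l(1) by (simp add: algebra_simps)
  then have m: "int ?m = (int s + 1) * l - int s * k" using p(2) by simp
  have "[int s * fermat_quotient p (int s) - (int s + 1) * fermat_quotient p (int s + 1) =
      int s * k - (int s + 1) * l] (mod ?p)"
    using k(2) l(2) by (intro cong_diff cong_mult) auto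
  then have "?p dvd int s * k - (int s + 1) * l" using dv by (simp add: cong_dvd_iff)
  then have "?p dvd int ?m" unfolding m by (metis dvd_minus_iff minus_diff_eq)
  then show ?thesis by (simp only: int_dvd_int_iff)
qed

text \<open>Reduction modulo p is injective on 1, ..., p - 2 and avoids 0 and -1, so it embeds the
  zeros of the symbol into the roots already counted.\<close>

lemma N0_mult_le_of_finite_field:
  fixes c :: nat
  assumes "CARD('a::finite_field) = CHAR('a)" "c > 0" "8 * c ^ 3 \<le> CHAR('a)"
  shows "N0 CHAR('a) * c \<le> 4 * CHAR('a)"
proof -
  let ?p = "CHAR('a)"
  let ?S = "{s \<in> {1..?p - 2}. vartheta ?p s = 0}"
  let ?R = "{x :: 'a. x \<noteq> 0 \<and> x \<noteq> -1 \<and> poly log_poly x = 0}"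
  have prim: "prime ?p" by simp
  have "inj_on (of_nat :: nat \<Rightarrow> 'a) ?S"
  proof (rule inj_onI)
    fix s t assume st: "s \<in> ?S" "t \<in> ?S" "(of_nat s :: 'a) = of_nat t"
    have "[s = t] (mod ?p)" using st(3) by (simp add: of_nat_eq_iff_cong_CHAR)
    moreover have "s < ?p" "t < ?p" using st by auto
    ultimately show "s = t" by (simp add: cong_def)
  qed
  moreover have "of_nat ` ?S \<subseteq> ?R"
  proof
    fix x :: 'a assume "x \<in> of_nat ` ?S"
    then obtain s where s: "s \<in> {1..?p - 2}" "vartheta ?p s = 0" and x: "x = of_nat s" by auto
    have "\<not> ?p dvd s" "\<not> ?p dvd s + 1" using s(1) by (auto dest!: dvd_imp_le)
    then have "of_nat s \<noteq> (0 :: 'a)" "of_nat (s + 1) \<noteq> (0 :: 'a)"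
      unfolding of_nat_eq_0_iff_char_dvd by auto
    moreover have "poly log_poly x = 0"
      unfolding x poly_log_poly_of_nat of_nat_eq_0_iff_char_dvd
      by (rule vartheta_eq_0_imp_dvd[OF prim s])
    ultimately show "x \<in> ?R" unfolding x by (auto simp: add_eq_0_iff)
  qed
  ultimately have "N0 ?p \<le> card ?R" unfolding N0_def by (intro card_inj_on_le) auto
  then have "N0 ?p * c \<le> card ?R * c" by simp
  then show ?thesis using card_log_poly_roots[OF assms] by linarith
qed

section \<open>Transfer from finite field types to all primes\<close>

text \<open>
  A type cannot depend on the variable \<open>p\<close>, but it can depend on a constant. So the bound is
  transferred from a finite field type to all primes by contradiction: one type is built whose
  cardinality is a counterexample if there is any.
\<close>
definition exceptional :: "nat \<Rightarrow> bool" where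
  "exceptional p \<longleftrightarrow> prime p \<and> (\<exists>c>0. 8 * c ^ 3 \<le> p \<and> \<not> N0 p * c \<le> 4 * p)"

text \<open>The default 2 keeps the number prime when there is no counterexample, since the type
  below is built unconditionally.\<close>

definition exceptional_prime :: nat where
  "exceptional_prime = (if \<exists>p. exceptional p then SOME p. exceptional p else 2)"

lemma prime_exceptional_prime: "prime exceptional_prime"
  using someI_ex[of exceptional] by (auto simp: exceptional_prime_def exceptional_def)

typedef exceptional_index = "{..<exceptional_prime}"
  using prime_gt_0_nat[OF prime_exceptional_prime] by auto

lemma CARD_exceptional_index: "CARD(exceptional_index) = exceptional_prime"
  using type_definition.card[OF type_definition_exceptional_index] by simp

instance exceptional_index :: prime_card
  by intro_classes (simp add: CARD_exceptional_index prime_exceptional_prime)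

lemma N0_mult_le:
  fixes c :: nat
  assumes "prime p" "c > 0" "8 * c ^ 3 \<le> p"
  shows "N0 p * c \<le> 4 * p"
proof (rule ccontr)
  assume "\<not> ?thesis"
  then have "exceptional p" using assms by (auto simp: exceptional_def)
  then have "exceptional exceptional_prime"
    unfolding exceptional_prime_def using someI[of exceptional] by auto
  then obtain d where "d > 0" "8 * d ^ 3 \<le> exceptional_prime"
    "\<not> N0 exceptional_prime * d \<le> 4 * exceptional_prime" by (auto simp: exceptional_def)
  \<comment> \<open>\<open>exceptional_index mod_ring\<close> is a field whose cardinality and
    characteristic are both \<open>exceptional_prime\<close>.\<close>
  then show False
    using N0_mult_le_of_finite_field[where ?'a = "exceptional_index mod_ring", of d]
    by (simp add: CARD_exceptional_index)
qed

section \<open>The bound with exponent 2/3\<close>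

theorem theorem3p1:
  shows "\<exists>C::real. C > 0 \<and> (\<forall>p::nat. prime p \<longrightarrow> real (N0 p) \<le> C * real p powr (2 / 3))"
proof (intro exI[of _ 16] conjI allI impI)
  fix p :: nat
  assume p: "prime p"
  define r where "r = real p powr (1 / 3)"
  have p0: "real p > 0" using p by (simp add: prime_gt_0_nat)
  have r2: "real p powr (2 / 3) = r ^ 2" and r3: "real p = r ^ 3"
    using p0 by (simp_all add: r_def powr_power)
  show "real (N0 p) \<le> 16 * real p powr (2 / 3)"
  proof (cases "r < 2")
    \<comment> \<open>Here r / 2 has floor 0, so no admissible c exists; the trivial bound by p =
      r^3 suffices.\<close>
    case True
    have "N0 p \<le> card {1..p - 2}" unfolding N0_def by (intro card_mono) auto
    then have "real (N0 p) \<le> r ^ 3" using r3 by simp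
    also have "\<dots> = r * r ^ 2" by (simp add: power3_eq_cube power2_eq_square)
    also have "\<dots> \<le> 16 * r ^ 2" using True by (intro mult_right_mono) auto
    finally show ?thesis by (simp add: r2)
  next
    case False
    \<comment> \<open>The largest c with 8 c^3 <= p. From c >= 1 follows r < 2 c + 2 <= 4 c, so 4 p
      / c is at most 16 r^2, which is the origin of the constant 16.\<close>
    define c where "c = nat \<lfloor>r / 2\<rfloor>"
    have c: "c \<ge> 1" "real c \<le> r / 2" "r / 2 < real c + 1"
      using False unfolding c_def by linarith+
    have "(2 * real c) ^ 3 \<le> r ^ 3" using c by (intro power_mono) auto
    then have "real (8 * c ^ 3) \<le> real p" unfolding r3 by (simp add: power_mult_distrib)
    then have "8 * c ^ 3 \<le> p" by (simp only: of_nat_le_iff)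
    then have "N0 p * c \<le> 4 * p" using c(1) by (intro N0_mult_le[OF p]) auto
    then have "real (N0 p) * real c \<le> 4 * r ^ 3"
      unfolding r3[symmetric] by (metis of_nat_mult of_nat_le_iff of_nat_numeral)
    moreover have "r \<le> 4 * real c" using c by linarith
    then have "4 * r ^ 3 \<le> 16 * r ^ 2 * real c"
      using mult_left_mono[of r "4 * real c" "4 * r ^ 2"] by (simp add: power3_eq_cube power2_eq_square mult_ac)
    ultimately have "real (N0 p) * real c \<le> 16 * r ^ 2 * real c" by linarith
    then show ?thesis unfolding r2 using c by simp
  qed
qed simp

end
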